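(* Let $(X,+)$ be a right cancellative semigroup with a summation system $\Sigma$ such that prefix associativity holds for constant families. Let $a\in X$. If the constant family $(a)_{i\in\mathbb N}\in X^{\mathbb N}$ is summable, then $a+a=a$. Moreover, if $(X,+)$ has a left identity $0$, then $a=0$.
   Context: $\mathbb N=\{0,1,2,\dots\}$. A summation system on a set $X$ is a partial function $\Sigma\colon\bigcup_I X^I\to X$, the union running over all sets $I$; a family is summable if it lies in $\mathrm{dom}(\Sigma)$. The operation $+$ is not assumed to be related to $\Sigma$ other than as stated. Prefix associativity: if $\underline a=(a_i)_{i\in\mathbb N}$ is summable, then so is the left shift $\underline a'=(a_{i+1})_{i\in\mathbb N}$, and $\Sigma\underline a=a_0+\Sigma\underline a'$. Here this is required only for constant families $\underline a$, i.e. $\Sigma(a)_{i\in\mathbb N}=a+\Sigma(a)_{i\in\mathbb N}$ whenever $(a)_{i\in\mathbb N}$ is summable. *)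

theory Defs
  imports Main "HOL-Library.FuncSet"
begin

text \<open>
  The index sets of families are the subsets of an arbitrary type \<open>'i\<close>, which plays the
  role of the universe of sets. A family \<open>(a\<^sub>i)\<^sub>i\<^sub>\<in>\<^sub>I\<close> is the pair of its index set and a function
  that is extensional on that set, so that equal families are equal pairs. A summation
  system is then a partial map on pairs whose domain consists of families.
\<close>

type_synonym ('i, 'x) family = "'i set \<times> ('i \<Rightarrow> 'x)"

definition families :: "('i, 'x) family set" where
  "families = {(I, f). f \<in> extensional I}"

definition summation_system :: "(('i, 'x) family \<rightharpoonup> 'x) \<Rightarrow> bool" where
  "summation_system S \<longleftrightarrow> dom S \<subseteq> families"

definition summable_family :: "(('i, 'x) family \<rightharpoonup> 'x) \<Rightarrow> ('i, 'x) family \<Rightarrow> bool" where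
  "summable_family S F \<longleftrightarrow> F \<in> dom S"

text \<open>
  The natural numbers enter the universe \<open>'i\<close> through an injection \<open>e\<close>; the family
  \<open>(a\<^sub>i)\<^sub>i\<^sub>\<in>\<^sub>\<nat>\<close> is the family on \<open>range e\<close> with value \<open>a n\<close> at \<open>e n\<close>. For \<open>'i = nat\<close>
  one may take \<open>e = id\<close>.
\<close>

definition nat_family :: "(nat \<Rightarrow> 'i) \<Rightarrow> (nat \<Rightarrow> 'x) \<Rightarrow> ('i, 'x) family" where
  "nat_family e a = (range e, \<lambda>i\<in>range e. a (inv e i))"

definition prefix_associative_at ::
    "(nat \<Rightarrow> 'i) \<Rightarrow> (('i, 'x::plus) family \<rightharpoonup> 'x) \<Rightarrow> (nat \<Rightarrow> 'x) \<Rightarrow> bool" where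
  "prefix_associative_at e S a \<longleftrightarrow>
     (summable_family S (nat_family e a) \<longrightarrow>
        summable_family S (nat_family e (\<lambda>i. a (i + 1))) \<and>
        the (S (nat_family e a)) = a 0 + the (S (nat_family e (\<lambda>i. a (i + 1)))))"

end

theory Submission imports Defs begin

text \<open>A constant family equals its own left shift, so its sum \<open>s\<close> absorbs its
  entry: \<open>a + s = s\<close>. Adding \<open>a\<close> on the left and cancelling
  \<open>s\<close> on the right makes \<open>a\<close> idempotent. In a right cancellative
  semigroup, the only idempotent that can coexist with a left identity is that identity.\<close>

theorem theorem4p2:
  fixes S :: "('i, 'x::semigroup_add) family \<rightharpoonup> 'x"
    and e :: "nat \<Rightarrow> 'i"
    and a :: 'x
  assumes right_cancel: "\<And>x y z :: 'x. x + z = y + z \<Longrightarrow> x = y"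
    and nat_embedding: "inj e"
    and system: "summation_system S"
    and prefix_assoc: "\<And>x. prefix_associative_at e S (\<lambda>_. x)"
    and summable: "summable_family S (nat_family e (\<lambda>_. a))"
  shows "a + a = a \<and> (\<forall>zero :: 'x. (\<forall>x. zero + x = x) \<longrightarrow> a = zero)"
proof -
  define s where "s = the (S (nat_family e (\<lambda>_. a)))"
  have s: "a + s = s"
    using prefix_assoc[of a] summable by (simp add: prefix_associative_at_def s_def)
  have "(a + a) + s = a + s"
    by (simp add: add.assoc s)
  then have idem: "a + a = a"
    by (rule right_cancel)
  moreover have "a = zero" if "\<forall>x. zero + x = x" for zero
    \<comment> \<open>The cancelled equation is \<open>a + a = zero + a\<close>, whose two sides
      both equal \<open>a\<close>.\<close>
    using right_cancel[of a a zero] idem that by simp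
  ultimately show ?thesis
    by blast
qed

end
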